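(* Let $0<a<b$, $s\in(0,1)$ and $q\ge1$. Then $$\left|A^s(a,b)-L_s^s(a,b)\right|\le s\,\frac{b-a}{8}\Big(\frac23\Big)^{\frac1q}\left\{\left[A\big(a^{q(s-1)},3b^{q(s-1)}\big)\right]^{1/q}+\left[A\big(3a^{q(s-1)},b^{q(s-1)}\big)\right]^{1/q}\right\}.$$
   Context: For positive reals $u,v$: $A(u,v)=\frac{u+v}{2}$ is the arithmetic mean. For positive reals $a\ne b$ and $p\in\mathbb{R}\setminus\{-1,0\}$, $L_p(a,b)=\left[\frac{b^{p+1}-a^{p+1}}{(p+1)(b-a)}\right]^{1/p}$ is the $p$-logarithmic mean. $A^s(a,b)$ and $L_s^s(a,b)$ denote $(A(a,b))^s$ and $(L_s(a,b))^s$. *)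

theory Defs
  imports Complex_Main
begin

definition arith_mean :: "real \<Rightarrow> real \<Rightarrow> real" where
  "arith_mean u v = (u + v) / 2"

(* Meaningful for positive a \<noteq> b and p \<notin> {-1, 0}; the base of the outer power is then positive. *)
definition p_log_mean :: "real \<Rightarrow> real \<Rightarrow> real \<Rightarrow> real" where
  "p_log_mean p a b =
     ((b powr (p + 1) - a powr (p + 1)) / ((p + 1) * (b - a))) powr (1 / p)"

end

theory Submission
  imports Defs
begin

text \<open>
  Let \<open>f x = x powr s\<close>, so that \<open>L\<^sub>s\<^sup>s\<close> is the mean value of \<open>f\<close> over \<open>[a, b]\<close>. Expanding the
  antiderivative of \<open>f\<close> to second order at the midpoint shows that the midpoint value differs from
  the mean value by \<open>(b - a) / 8 * (f' \<eta> - f' \<xi>)\<close> with \<open>\<eta>\<close> in the left and \<open>\<xi>\<close> in the right half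
  of the interval. Since \<open>f'\<close> is positive and decreasing, this is at most
  \<open>(b - a) / 8 * (f' a + f' b)\<close>, and the right-hand side of the claim is at least as large for
  every \<open>q\<close>, because \<open>(u + 3 * v) / 3 \<ge> v\<close>.
\<close>

lemma midpoint_error_bound:
  fixes F f f' :: "real \<Rightarrow> real"
  assumes "a < b"
    and F: "\<And>x. a \<le> x \<Longrightarrow> x \<le> b \<Longrightarrow> (F has_real_derivative f x) (at x)"
    and f: "\<And>x. a \<le> x \<Longrightarrow> x \<le> b \<Longrightarrow> (f has_real_derivative f' x) (at x)"
    and anti: "\<And>x y. a \<le> x \<Longrightarrow> x \<le> y \<Longrightarrow> y \<le> b \<Longrightarrow> f' y \<le> f' x"
  shows "\<bar>f ((a + b) / 2) - (F b - F a) / (b - a)\<bar> \<le> (b - a) / 8 * (f' a - f' b)"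
proof -
  define m where "m = (a + b) / 2"
  have m: "a < m" "m < b" "b - m = (b - a) / 2" "a - m = - (b - a) / 2"
    using \<open>a < b\<close> by (auto simp: m_def field_simps)
  \<comment> \<open>The chain of derivatives that Taylor's theorem takes as input; with order 2 only
    the indices 0, 1 and 2 matter.\<close>
  define D where "D = (\<lambda>n::nat. if n = 0 then F else if n = 1 then f else f')"
  have D: "\<forall>n x. n < 2 \<and> a \<le> x \<and> x \<le> b \<longrightarrow> (D n has_real_derivative D (Suc n) x) (at x)"
    using F f by (auto simp: D_def less_2_cases_iff)
  obtain \<xi> where \<xi>: "m < \<xi>" "\<xi> < b" "F b = F m + f m * (b - m) + f' \<xi> / 2 * (b - m)\<^sup>2"
    using Taylor_up[of 2 D F a b m] D m by (auto simp: D_def numeral_2_eq_2)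
  obtain \<eta> where \<eta>: "a < \<eta>" "\<eta> < m" "F a = F m + f m * (a - m) + f' \<eta> / 2 * (a - m)\<^sup>2"
    using Taylor_down[of 2 D F a b m] D m by (auto simp: D_def numeral_2_eq_2)
  \<comment> \<open>Both halves have length \<open>(b - a) / 2\<close>, so the first-order terms add
    up to \<open>(b - a) * f m\<close>, while the quadratic remainders subtract with the common
    factor \<open>(b - a)\<^sup>2 / 8\<close>.\<close>
  have "F b - F a = (b - a) * (f m + (b - a) / 8 * (f' \<xi> - f' \<eta>))"
    unfolding \<xi>(3) \<eta>(3) m(3,4) by (simp add: field_simps power2_eq_square)
  then have "f m - (F b - F a) / (b - a) = (b - a) / 8 * (f' \<eta> - f' \<xi>)"
    using \<open>a < b\<close> by (simp add: field_simps)
  moreover have "\<bar>f' \<eta> - f' \<xi>\<bar> \<le> f' a - f' b"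
    using anti[of a \<eta>] anti[of \<eta> \<xi>] anti[of \<xi> b] \<xi> \<eta> m by auto
  ultimately have "\<bar>f m - (F b - F a) / (b - a)\<bar> \<le> (b - a) / 8 * (f' a - f' b)"
    using \<open>a < b\<close> by (simp only: abs_mult) (intro mult_mono, auto)
  then show ?thesis
    by (simp only: m_def)
qed

text \<open>The base of the outer power is positive, so the exponents \<open>1 / s\<close> and
  \<open>s\<close> cancel. The quotient is split to show the antiderivative
  \<open>x powr (s + 1) / (s + 1)\<close>, which serves as \<open>F\<close> in
  \<open>midpoint_error_bound\<close>.\<close>

lemma p_log_mean_powr_self:
  assumes "0 < a" "a < b" "0 < s"
  shows "p_log_mean s a b powr s = (b powr (s + 1) / (s + 1) - a powr (s + 1) / (s + 1)) / (b - a)"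
proof -
  have "a powr (s + 1) < b powr (s + 1)"
    using assms by (intro powr_less_mono2) auto
  moreover from this have "0 < (b powr (s + 1) - a powr (s + 1)) / ((s + 1) * (b - a))"
    using assms by simp
  ultimately show ?thesis
    using assms by (simp add: p_log_mean_def powr_powr diff_divide_distrib[symmetric])
qed

text \<open>The mean gives \<open>v\<close> the weight 3/2, which the factor 2/3 turns into 1; the
  surplus \<open>u / 3\<close> is nonnegative.\<close>

lemma arith_mean_weighted_powr_ge:
  assumes "0 \<le> u" "0 \<le> v" "0 < q"
  shows "v powr (1 / q) \<le> (2 / 3) powr (1 / q) * arith_mean u (3 * v) powr (1 / q)"
proof -
  have "v powr (1 / q) \<le> (2 / 3 * arith_mean u (3 * v)) powr (1 / q)"
    using assms by (intro powr_mono2) (auto simp: arith_mean_def)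
  also have "\<dots> = (2 / 3) powr (1 / q) * arith_mean u (3 * v) powr (1 / q)"
    using assms by (intro powr_mult)
  finally show ?thesis .
qed

theorem proposition3:
  fixes a b s q :: real
  assumes "0 < a" and "a < b" and "0 < s" and "s < 1" and "1 \<le> q"
  shows "\<bar>arith_mean a b powr s - p_log_mean s a b powr s\<bar>
    \<le> s * ((b - a) / 8) * (2 / 3) powr (1 / q) *
       (arith_mean (a powr (q * (s - 1))) (3 * b powr (q * (s - 1))) powr (1 / q)
        + arith_mean (3 * a powr (q * (s - 1))) (b powr (q * (s - 1))) powr (1 / q))"
proof -
  let ?A = "a powr (q * (s - 1))" and ?B = "b powr (q * (s - 1))"
  have "\<bar>arith_mean a b powr s - p_log_mean s a b powr s\<bar>
      \<le> (b - a) / 8 * (s * a powr (s - 1) - s * b powr (s - 1))"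
    unfolding p_log_mean_powr_self[OF assms(1-3)] arith_mean_def
  proof (rule midpoint_error_bound[OF assms(2)])
    fix x assume "a \<le> x" "x \<le> b"
    with assms have "((\<lambda>x. x powr (s + 1)) has_real_derivative (s + 1) * x powr s) (at x)"
      by (auto intro!: derivative_eq_intros)
    from DERIV_cdivide[OF this, of "s + 1"] assms
    show "((\<lambda>x. x powr (s + 1) / (s + 1)) has_real_derivative x powr s) (at x)"
      by simp
  next
    fix x assume "a \<le> x" "x \<le> b"
    with assms show "((\<lambda>x. x powr s) has_real_derivative s * x powr (s - 1)) (at x)"
      by (auto intro!: derivative_eq_intros)
  next
    fix x y assume "a \<le> x" "x \<le> y" "y \<le> b"
    with assms show "s * y powr (s - 1) \<le> s * x powr (s - 1)"
      by (intro mult_left_mono powr_mono2') auto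
  qed
  also have "\<dots> = s * ((b - a) / 8) * (a powr (s - 1) - b powr (s - 1))"
    by (simp add: field_simps)
  \<comment> \<open>Flipping the sign of the nonnegative \<open>b powr (s - 1)\<close> turns the
    difference into the sum that the two means dominate term by term.\<close>
  also have "\<dots> \<le> s * ((b - a) / 8) * (b powr (s - 1) + a powr (s - 1))"
    using assms by (intro mult_left_mono) auto
  also have "b powr (s - 1) + a powr (s - 1) = ?B powr (1 / q) + ?A powr (1 / q)"
    using assms by (simp add: powr_powr)
  \<comment> \<open>Each power is bounded by the mean in which its own entry is tripled, so the
    second use exchanges \<open>?A\<close> and \<open>?B\<close>.\<close>
  also have "s * ((b - a) / 8) * \<dots> \<le> s * ((b - a) / 8) *
      ((2 / 3) powr (1 / q) * arith_mean ?A (3 * ?B) powr (1 / q)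
       + (2 / 3) powr (1 / q) * arith_mean ?B (3 * ?A) powr (1 / q))"
    using assms by (intro mult_left_mono add_mono arith_mean_weighted_powr_ge) auto
  also have "arith_mean ?B (3 * ?A) = arith_mean (3 * ?A) ?B"
    by (simp add: arith_mean_def add.commute)
  finally show ?thesis
    by (simp only: distrib_left mult.assoc)
qed

end
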